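(* Let $G$ be a simple mixed graph on $n$ vertices. Then $\boldsymbol{\nu}_1(G)\leq 2\nu_1(G_u)+\max_{u\in V_G}d^+(u)+\max_{u\in V_G}d^-(u)$, where $\boldsymbol{\nu}_1(G)$ is the largest eigenvalue of the integrated Laplacian matrix of $G$ and $\nu_1(G_u)$ is the largest eigenvalue of the (ordinary) Laplacian matrix $L(G_u)=D(G_u)-A(G_u)$ of the undirected part $G_u$ of $G$.
   Context: A mixed graph $G$ has a finite vertex set $V_G$, a multiset $E_G$ of edges (unordered pairs) and a multiset $\vec{E}_G$ of arcs (ordered pairs); it is simple if it has no loops, directed loops, multiple edges or multiple arcs. The undirected part $G_u$ is the graph $(V_G,E_G)$. $d(v)$ is the number of edges at $v$; $d^+(v)$ (resp. $d^-(v)$) is the number of arcs starting (resp. ending) at $v$. For $V_G=\{v_1,\dots,v_n\}$, the integrated adjacency matrix $\mathcal{I}(G)$ is the $2n\times 2n$ matrix indexed by $v'_1,\dots,v'_n,v''_1,\dots,v''_n$ whose $(v'_i,v'_j)$ and $(v''_i,v''_j)$ entries are the number of edges joining $v_i,v_j$ and whose $(v'_i,v''_j)$ and $(v''_j,v'_i)$ entries are the number of arcs from $v_i$ to $v_j$. The integrated degree matrix $\mathcal{I}^D(G)$ is diagonal with $(v'_i,v'_i)$ entry $d(v_i)+d^+(v_i)$ and $(v''_i,v''_i)$ entry $d(v_i)+d^-(v_i)$; the integrated Laplacian matrix is $\mathcal{I}^L(G)=\mathcal{I}^D(G)-\mathcal{I}(G)$. *)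

theory Defs
  imports
    Complex_Main
    "HOL-Library.Multiset"
    "HOL-Library.Uprod"
    "Jordan_Normal_Form.Spectral_Radius"
begin

record 'v multi_graph =
  verts :: "'v set"
  edges :: "'v uprod multiset"

record 'v mixed_graph = "'v multi_graph" +
  arcs :: "('v \<times> 'v) multiset"

definition mixed_graph :: "'v mixed_graph \<Rightarrow> bool" where
  "mixed_graph G \<longleftrightarrow>
     finite (verts G) \<and>
     (\<forall>e\<in>#edges G. set_uprod e \<subseteq> verts G) \<and>
     (\<forall>a\<in>#arcs G. a \<in> verts G \<times> verts G)"

(* Arcs are ordered pairs, so an edge between u and v, an arc from u to v and an arc
   from v to u may all be present together in a simple mixed graph. *)
definition simple_mixed_graph :: "'v mixed_graph \<Rightarrow> bool" where
  "simple_mixed_graph G \<longleftrightarrow>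
     mixed_graph G \<and>
     (\<forall>v. Upair v v \<notin># edges G) \<and>
     (\<forall>v. (v, v) \<notin># arcs G) \<and>
     (\<forall>e. count (edges G) e \<le> 1) \<and>
     (\<forall>a. count (arcs G) a \<le> 1)"

definition undirected_part :: "'v mixed_graph \<Rightarrow> 'v multi_graph" where
  "undirected_part G = \<lparr>verts = verts G, edges = edges G\<rparr>"

(* A loop would count once here; the convention is immaterial for simple graphs. *)
definition vertex_degree :: "('v, 'b) multi_graph_scheme \<Rightarrow> 'v \<Rightarrow> nat" where
  "vertex_degree G v = size {#e \<in># edges G. v \<in> set_uprod e#}"

definition out_degree :: "'v mixed_graph \<Rightarrow> 'v \<Rightarrow> nat" where
  "out_degree G v = size {#a \<in># arcs G. fst a = v#}"

definition in_degree :: "'v mixed_graph \<Rightarrow> 'v \<Rightarrow> nat" where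
  "in_degree G v = size {#a \<in># arcs G. snd a = v#}"

(* In all matrices below, vs is an enumeration v_1, ..., v_n of the vertices. *)

definition adjacency_matrix :: "('v, 'b) multi_graph_scheme \<Rightarrow> 'v list \<Rightarrow> real mat" where
  "adjacency_matrix G vs =
     mat (length vs) (length vs) (\<lambda>(i, j). real (count (edges G) (Upair (vs ! i) (vs ! j))))"

definition degree_matrix :: "('v, 'b) multi_graph_scheme \<Rightarrow> 'v list \<Rightarrow> real mat" where
  "degree_matrix G vs = mat_diag (length vs) (\<lambda>i. real (vertex_degree G (vs ! i)))"

definition laplacian_matrix :: "('v, 'b) multi_graph_scheme \<Rightarrow> 'v list \<Rightarrow> real mat" where
  "laplacian_matrix G vs = degree_matrix G vs - adjacency_matrix G vs"

definition arc_matrix :: "'v mixed_graph \<Rightarrow> 'v list \<Rightarrow> real mat" where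
  "arc_matrix G vs =
     mat (length vs) (length vs) (\<lambda>(i, j). real (count (arcs G) (vs ! i, vs ! j)))"

(* The 2n x 2n matrices list the indices v'_1, ..., v'_n first, then v''_1, ..., v''_n. *)

definition integrated_adjacency_matrix :: "'v mixed_graph \<Rightarrow> 'v list \<Rightarrow> real mat" where
  "integrated_adjacency_matrix G vs =
     four_block_mat
       (adjacency_matrix G vs)                (arc_matrix G vs)
       (transpose_mat (arc_matrix G vs))      (adjacency_matrix G vs)"

definition integrated_degree_matrix :: "'v mixed_graph \<Rightarrow> 'v list \<Rightarrow> real mat" where
  "integrated_degree_matrix G vs =
     (let n = length vs in
      four_block_mat
        (mat_diag n (\<lambda>i. real (vertex_degree G (vs ! i) + out_degree G (vs ! i))))   (0\<^sub>m n n)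
        (0\<^sub>m n n)   (mat_diag n (\<lambda>i. real (vertex_degree G (vs ! i) + in_degree G (vs ! i)))))"

definition integrated_laplacian_matrix :: "'v mixed_graph \<Rightarrow> 'v list \<Rightarrow> real mat" where
  "integrated_laplacian_matrix G vs =
     integrated_degree_matrix G vs - integrated_adjacency_matrix G vs"

(* Meaningful for real symmetric matrices of positive dimension: their eigenvalues are all
   real and the spectrum is finite and nonempty. *)
definition largest_eigenvalue :: "real mat \<Rightarrow> real" where
  "largest_eigenvalue A = Max (spectrum A)"

end

theory Submission
  imports Defs
begin

text \<open>At a vector with halves \<open>x\<close> and \<open>y\<close> the form of the integrated Laplacian is the sum of the
  Laplacian forms of the undirected part at \<open>x\<close> and at \<open>y\<close> and of \<open>(x\<^sub>u - y\<^sub>v)\<^sup>2\<close> over all arcs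
  \<open>(u, v)\<close>. The arc part is at most \<open>max d\<^sup>+ + max d\<^sup>-\<close> times the squared norm by a weighted AM-GM
  inequality, so that \<open>\<nu>\<^sub>1(G\<^sub>u)\<close> already suffices in the bound; the factor \<open>2\<close> is harmless
  because \<open>\<nu>\<^sub>1(G\<^sub>u) \<ge> 0\<close>.\<close>

section \<open>Coordinate formulas and bounds for real quadratic forms\<close>

lemma quadratic_form_eq_sum:
  fixes A :: "'a::comm_semiring_0 mat"
  assumes "A \<in> carrier_mat nr nc" "x \<in> carrier_vec nr" "y \<in> carrier_vec nc"
  shows "x \<bullet> (A *\<^sub>v y) = (\<Sum>i<nr. \<Sum>j<nc. A $$ (i, j) * x $ i * y $ j)"
proof -
  have "x \<bullet> (A *\<^sub>v y) = (\<Sum>i<nr. x $ i * (\<Sum>j<nc. A $$ (i, j) * y $ j))"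
    using assms by (auto simp: scalar_prod_def lessThan_atLeast0 intro!: sum.cong)
  then show ?thesis
    by (simp add: sum_distrib_left ac_simps)
qed

lemma scalar_prod_self_eq_sum:
  fixes x :: "real vec"
  assumes "x \<in> carrier_vec n"
  shows "x \<bullet> x = (\<Sum>i<n. (x $ i)\<^sup>2)"
  using assms by (auto simp: scalar_prod_def lessThan_atLeast0 power2_eq_square)

lemma scalar_prod_self_pos:
  fixes x :: "real vec"
  assumes "x \<in> carrier_vec n" "x \<noteq> 0\<^sub>v n"
  shows "x \<bullet> x > 0"
proof -
  obtain i where "i < n" "x $ i \<noteq> 0"
    using assms by (metis eq_vecI carrier_vecD index_zero_vec)
  then show ?thesis
    unfolding scalar_prod_self_eq_sum[OF assms(1)] by (intro sum_pos2[of _ i]) auto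
qed

text \<open>Each product of two coordinates is at most \<open>x \<bullet> x\<close> in absolute
  value, so the entrywise absolute sum of \<open>A\<close> bounds the form. This serves both for
  \<open>A\<close> itself and for the inverse of a characteristic matrix.\<close>

lemma quadratic_form_bounded:
  fixes A :: "real mat"
  assumes A: "A \<in> carrier_mat n n"
  obtains C where "C > 0" "\<And>x. x \<in> carrier_vec n \<Longrightarrow> \<bar>x \<bullet> (A *\<^sub>v x)\<bar> \<le> C * (x \<bullet> x)"
proof
  \<comment> \<open>The summand 1 keeps \<open>C\<close> positive even for the zero matrix, so that
    \<open>1 / C\<close> can later be a step size.\<close>
  define C where "C = (\<Sum>i<n. \<Sum>j<n. \<bar>A $$ (i, j)\<bar>) + 1"
  show "C > 0"
    unfolding C_def by (intro add_nonneg_pos sum_nonneg) auto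
  fix x :: "real vec"
  assume x: "x \<in> carrier_vec n"
  have coord: "(x $ i)\<^sup>2 \<le> x \<bullet> x" if "i < n" for i
    unfolding scalar_prod_self_eq_sum[OF x] using that by (intro member_le_sum) auto
  have entry: "\<bar>A $$ (i, j) * x $ i * x $ j\<bar> \<le> \<bar>A $$ (i, j)\<bar> * (x \<bullet> x)"
    if "i < n" "j < n" for i j
  proof -
    have "2 * (\<bar>x $ i\<bar> * \<bar>x $ j\<bar>) \<le> (x $ i)\<^sup>2 + (x $ j)\<^sup>2"
      using zero_le_power2[of "\<bar>x $ i\<bar> - \<bar>x $ j\<bar>"] by (simp add: power2_diff)
    then have "\<bar>x $ i\<bar> * \<bar>x $ j\<bar> \<le> x \<bullet> x"
      using coord that by (smt (verit))
    then show ?thesis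
      by (simp add: abs_mult mult.assoc mult_left_mono)
  qed
  have "\<bar>x \<bullet> (A *\<^sub>v x)\<bar> \<le> (\<Sum>i<n. \<Sum>j<n. \<bar>A $$ (i, j)\<bar> * (x \<bullet> x))"
    unfolding quadratic_form_eq_sum[OF A x x]
    by (intro order_trans[OF sum_abs] sum_mono entry) auto
  also have "\<dots> \<le> C * (x \<bullet> x)"
    using scalar_prod_self_eq_sum[OF x]
    by (simp add: C_def sum_distrib_right distrib_right sum_nonneg)
  finally show "\<bar>x \<bullet> (A *\<^sub>v x)\<bar> \<le> C * (x \<bullet> x)" .
qed

section \<open>Rayleigh bounds and the largest eigenvalue of a symmetric matrix\<close>

text \<open>Symmetry merges the two cross terms. If \<open>z\<close> is a preimage of
  \<open>x\<close> under the matrix, the cross term becomes a multiple of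
  \<open>x \<bullet> x\<close>, which drives the perturbation argument below.\<close>

lemma quadratic_form_add_smult:
  fixes A :: "real mat"
  assumes A: "A \<in> carrier_mat n n" and sym: "A\<^sup>T = A"
    and x: "x \<in> carrier_vec n" and z: "z \<in> carrier_vec n"
  shows "(x + t \<cdot>\<^sub>v z) \<bullet> (A *\<^sub>v (x + t \<cdot>\<^sub>v z))
           = x \<bullet> (A *\<^sub>v x) + 2 * t * (x \<bullet> (A *\<^sub>v z)) + t\<^sup>2 * (z \<bullet> (A *\<^sub>v z))"
proof -
  have "z \<bullet> (A *\<^sub>v x) = x \<bullet> (A *\<^sub>v z)"
    using transpose_vec_mult_scalar[OF A x z] sym A x z
    by (metis comm_scalar_prod mult_mat_vec_carrier)
  moreover have "A *\<^sub>v (x + t \<cdot>\<^sub>v z) = A *\<^sub>v x + t \<cdot>\<^sub>v (A *\<^sub>v z)"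
    using A x z by (simp add: mult_add_distrib_mat_vec mult_mat_vec)
  moreover have "A *\<^sub>v x \<in> carrier_vec n" "A *\<^sub>v z \<in> carrier_vec n"
    using A x z by auto
  ultimately show ?thesis
    using x z
    by (simp add: add_scalar_prod_distrib[of _ n] scalar_prod_add_distrib[of _ n]
        power2_eq_square algebra_simps)
qed

text \<open>The infimum \<open>\<rho>\<close> of the upper bounds of the Rayleigh quotient is an eigenvalue: if
  \<open>K = A - \<rho> I\<close> had an inverse \<open>Y\<close>, then evaluating the negative semidefinite form of \<open>K\<close> at
  \<open>x + t Y x\<close> for a small \<open>t > 0\<close> would bound it away from \<open>0\<close>, so that \<open>\<rho>\<close> could be lowered.
  This needs no compactness and no passage to the complex numbers.\<close>

lemma symmetric_real_eigenvalue_bounds_quadratic_form: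
  fixes A :: "real mat"
  assumes A: "A \<in> carrier_mat n n" and sym: "A\<^sup>T = A" and n: "n > 0"
  obtains \<rho> where "eigenvalue A \<rho>"
    "\<And>x. x \<in> carrier_vec n \<Longrightarrow> x \<bullet> (A *\<^sub>v x) \<le> \<rho> * (x \<bullet> x)"
proof -
  define U where "U = {r. \<forall>x \<in> carrier_vec n. x \<bullet> (A *\<^sub>v x) \<le> r * (x \<bullet> x)}"
  define \<rho> where "\<rho> = Inf U"
  obtain C0 where "\<And>x. x \<in> carrier_vec n \<Longrightarrow> \<bar>x \<bullet> (A *\<^sub>v x)\<bar> \<le> C0 * (x \<bullet> x)"
    using quadratic_form_bounded[OF A] by blast
  then have "U \<noteq> {}"
    unfolding U_def using abs_le_D1 by blast
  have quot: "x \<bullet> (A *\<^sub>v x) / (x \<bullet> x) \<le> r"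
    if "x \<in> carrier_vec n" "x \<noteq> 0\<^sub>v n" "r \<in> U" for x r
    using that scalar_prod_self_pos[of x n] by (auto simp: U_def field_simps)
  \<comment> \<open>The Rayleigh quotient of any nonzero vector is a lower bound of
    \<open>U\<close>; positive dimension supplies such a vector.\<close>
  have "unit_vec n 0 \<noteq> (0\<^sub>v n :: real vec)"
    using n by (metis index_unit_vec(1) index_zero_vec(1) zero_neq_one)
  then have bdd: "bdd_below U"
    using quot[of "unit_vec n 0"] by (intro bdd_belowI) auto
  \<comment> \<open>Every Rayleigh quotient lies below all of \<open>U\<close>, hence below its
    infimum: the infimum is attained.\<close>
  have \<rho>: "x \<bullet> (A *\<^sub>v x) \<le> \<rho> * (x \<bullet> x)" if x: "x \<in> carrier_vec n" for x
  proof (cases "x = 0\<^sub>v n")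
    case True
    then show ?thesis using A by (simp add: scalar_prod_def)
  next
    case False
    then have "x \<bullet> (A *\<^sub>v x) / (x \<bullet> x) \<le> \<rho>"
      unfolding \<rho>_def using quot x by (intro cInf_greatest \<open>U \<noteq> {}\<close>) auto
    then show ?thesis
      using scalar_prod_self_pos[OF x False] by (simp add: field_simps)
  qed
  have "eigenvalue A \<rho>"
  proof (rule ccontr)
    assume not_ev: "\<not> eigenvalue A \<rho>"
    define K where "K = char_matrix A \<rho>"
    have K: "K \<in> carrier_mat n n"
      using A by (simp add: K_def)
    have symK: "K\<^sup>T = K"
    proof (rule eq_matI)
      fix i j assume ij: "i < dim_row K" "j < dim_col K"
      have "A $$ (j, i) = A $$ (i, j)"
        using sym A ij K by (metis carrier_matD index_transpose_mat(1))
      then show "K\<^sup>T $$ (i, j) = K $$ (i, j)"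
        using A ij K by (auto simp: K_def char_matrix_def)
    qed (use K in auto)
    have Kform: "x \<bullet> (K *\<^sub>v x) = x \<bullet> (A *\<^sub>v x) - \<rho> * (x \<bullet> x)"
      if x: "x \<in> carrier_vec n" for x
    proof -
      have "(- \<rho> \<cdot>\<^sub>m 1\<^sub>m n) *\<^sub>v x = (- \<rho>) \<cdot>\<^sub>v x"
        using x by (auto intro!: eq_vecI)
      then have "K *\<^sub>v x = A *\<^sub>v x + (- \<rho>) \<cdot>\<^sub>v x"
        using A x by (simp add: K_def char_matrix_def add_mult_distrib_mat_vec[of _ n n])
      moreover have "A *\<^sub>v x \<in> carrier_vec n"
        using A x by auto
      ultimately show ?thesis
        using x by (simp add: scalar_prod_add_distrib[of _ n])
    qed
    have "det K \<noteq> 0"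
      using not_ev eigenvalue_det[OF A] by (simp add: K_def)
    then obtain Y where Y: "Y \<in> carrier_mat n n" and KY: "K * Y = 1\<^sub>m n"
      using det_non_zero_imp_unit[OF K, where b = "()"]
      by (auto simp: Units_def ring_mat_def)
    obtain C where C: "C > 0" and
      boundY: "\<And>x. x \<in> carrier_vec n \<Longrightarrow> \<bar>x \<bullet> (Y *\<^sub>v x)\<bar> \<le> C * (x \<bullet> x)"
      using quadratic_form_bounded[OF Y] by blast
    \<comment> \<open>For step size t the expansion yields x.Kx \<le> -(2t - C t^2) x.x. The choice
      t = 1/C maximises 2t - C t^2, with value 1/C, which is exactly the amount by which
      \<open>\<rho>\<close> is lowered.\<close>
    have "\<rho> - 1 / C \<in> U"
      unfolding U_def
    proof safe
      fix x :: "real vec"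
      assume x: "x \<in> carrier_vec n"
      define z where "z = Y *\<^sub>v x"
      define w where "w = x + (1 / C) \<cdot>\<^sub>v z"
      have z: "z \<in> carrier_vec n" and Kz: "K *\<^sub>v z = x"
        using Y x KY K by (simp_all add: z_def assoc_mult_mat_vec[symmetric])
      have w: "w \<in> carrier_vec n"
        using x z by (simp add: w_def)
      have "0 \<ge> w \<bullet> (K *\<^sub>v w)"
        using Kform[OF w] \<rho>[OF w] by simp
      also have "w \<bullet> (K *\<^sub>v w) =
          x \<bullet> (K *\<^sub>v x) + 2 * (1 / C) * (x \<bullet> x) + (1 / C)\<^sup>2 * (z \<bullet> x)"
        unfolding w_def quadratic_form_add_smult[OF K symK x z] Kz ..
      also have "z \<bullet> x = x \<bullet> (Y *\<^sub>v x)"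
        using x z by (simp add: comm_scalar_prod[of _ n] z_def)
      finally have "x \<bullet> (K *\<^sub>v x) + 2 * (1 / C) * (x \<bullet> x) + (1 / C)\<^sup>2 * (x \<bullet> (Y *\<^sub>v x)) \<le> 0" .
      moreover have "(1 / C)\<^sup>2 * (x \<bullet> (Y *\<^sub>v x)) \<ge> (1 / C)\<^sup>2 * (- (C * (x \<bullet> x)))"
        using boundY[OF x] by (intro mult_left_mono) auto
      moreover have "(1 / C)\<^sup>2 * (- (C * (x \<bullet> x))) = - (1 / C) * (x \<bullet> x)"
        using C by (simp add: power2_eq_square)
      ultimately show "x \<bullet> (A *\<^sub>v x) \<le> (\<rho> - 1 / C) * (x \<bullet> x)"
        using Kform[OF x] by (simp add: left_diff_distrib)
    qed
    then have "\<rho> \<le> \<rho> - 1 / C"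
      unfolding \<rho>_def using bdd by (intro cInf_lower)
    then show False
      using C by simp
  qed
  then show thesis
    using \<rho> that by blast
qed

text \<open>\<open>Max\<close> is informative only on a finite nonempty set. The spectrum is finite,
  and the eigenvalue just constructed makes it nonempty; its bound on the form passes to the maximum
  because \<open>x \<bullet> x\<close> is nonnegative.\<close>

lemma largest_eigenvalue_symmetric:
  fixes A :: "real mat"
  assumes A: "A \<in> carrier_mat n n" and sym: "A\<^sup>T = A" and n: "n > 0"
  shows "eigenvalue A (largest_eigenvalue A)"
    and "x \<in> carrier_vec n \<Longrightarrow> x \<bullet> (A *\<^sub>v x) \<le> largest_eigenvalue A * (x \<bullet> x)"
proof -
  obtain \<rho> where ev: "eigenvalue A \<rho>" and
    \<rho>: "\<And>x. x \<in> carrier_vec n \<Longrightarrow> x \<bullet> (A *\<^sub>v x) \<le> \<rho> * (x \<bullet> x)"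
    using symmetric_real_eigenvalue_bounds_quadratic_form[OF assms] by blast
  have fin: "finite (spectrum A)"
    using card_finite_spectrum[OF A] by simp
  have mem: "\<rho> \<in> spectrum A"
    using ev by (simp add: spectrum_def)
  then show "eigenvalue A (largest_eigenvalue A)"
    using Max_in[OF fin] by (auto simp: largest_eigenvalue_def spectrum_def)
  show "x \<bullet> (A *\<^sub>v x) \<le> largest_eigenvalue A * (x \<bullet> x)" if x: "x \<in> carrier_vec n"
  proof -
    have "\<rho> * (x \<bullet> x) \<le> largest_eigenvalue A * (x \<bullet> x)"
      unfolding largest_eigenvalue_def scalar_prod_self_eq_sum[OF x]
      using Max_ge[OF fin mem] by (intro mult_right_mono sum_nonneg) auto
    then show ?thesis
      using \<rho>[OF x] by simp
  qed
qed

text \<open>Evaluate the bound at an eigenvector for the largest eigenvalue. This reduces the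
  theorem to an inequality between quadratic forms.\<close>

lemma largest_eigenvalue_le:
  fixes A :: "real mat"
  assumes A: "A \<in> carrier_mat n n" and sym: "A\<^sup>T = A" and n: "n > 0"
    and bound: "\<And>x. x \<in> carrier_vec n \<Longrightarrow> x \<bullet> (A *\<^sub>v x) \<le> c * (x \<bullet> x)"
  shows "largest_eigenvalue A \<le> c"
proof -
  obtain v where v: "v \<in> carrier_vec n" "v \<noteq> 0\<^sub>v n" "A *\<^sub>v v = largest_eigenvalue A \<cdot>\<^sub>v v"
    using largest_eigenvalue_symmetric(1)[OF A sym n] A
    by (auto simp: eigenvalue_def eigenvector_def)
  then have "largest_eigenvalue A * (v \<bullet> v) \<le> c * (v \<bullet> v)"
    using bound[OF v(1)] by simp
  then show ?thesis
    using scalar_prod_self_pos[OF v(1,2)] by simp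
qed

section \<open>Weighted AM-GM and degrees as sums of arc counts\<close>

text \<open>The proof sums \<open>-2 P Q x y \<le> Q\<^sup>2 x\<^sup>2 + P\<^sup>2 y\<^sup>2\<close> against the weights \<open>a i j\<close>.\<close>

lemma bilinear_sum_bound:
  fixes a :: "'i \<Rightarrow> 'j \<Rightarrow> real" and x :: "'i \<Rightarrow> real" and y :: "'j \<Rightarrow> real"
  assumes fin: "finite I" "finite J"
    and nonneg: "\<And>i j. i \<in> I \<Longrightarrow> j \<in> J \<Longrightarrow> a i j \<ge> 0"
    and row: "\<And>i. i \<in> I \<Longrightarrow> (\<Sum>j\<in>J. a i j) \<le> P"
    and col: "\<And>j. j \<in> J \<Longrightarrow> (\<Sum>i\<in>I. a i j) \<le> Q"
    and PQ: "P \<ge> 0" "Q \<ge> 0"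
  shows "- 2 * (\<Sum>i\<in>I. \<Sum>j\<in>J. a i j * x i * y j) \<le> Q * (\<Sum>i\<in>I. (x i)\<^sup>2) + P * (\<Sum>j\<in>J. (y j)\<^sup>2)"
proof (cases "P = 0 \<or> Q = 0")
  \<comment> \<open>The general argument cancels the factor \<open>P * Q\<close>. If it is zero, all
    weights vanish and the left side is 0.\<close>
  case True
  have "a i j = 0" if "i \<in> I" "j \<in> J" for i j
  proof -
    have "a i j \<le> (\<Sum>j\<in>J. a i j)" "a i j \<le> (\<Sum>i\<in>I. a i j)"
      using that nonneg fin by (auto intro!: member_le_sum)
    then have "a i j \<le> P" "a i j \<le> Q"
      using row col that by fastforce+
    then show ?thesis
      using True nonneg[OF that] by auto
  qed
  then show ?thesis
    using PQ by (simp add: sum_nonneg)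
next
  case False
  then have pos: "P > 0" "Q > 0"
    using PQ by auto
  have "P * Q * (- 2 * (\<Sum>i\<in>I. \<Sum>j\<in>J. a i j * x i * y j))
      = (\<Sum>i\<in>I. \<Sum>j\<in>J. a i j * (- 2 * (Q * x i) * (P * y j)))"
    by (simp add: sum_distrib_left sum_negf ac_simps)
  also have "\<dots> \<le> (\<Sum>i\<in>I. \<Sum>j\<in>J. a i j * ((Q * x i)\<^sup>2 + (P * y j)\<^sup>2))"
  proof (intro sum_mono mult_left_mono)
    show "- 2 * (Q * x i) * (P * y j) \<le> (Q * x i)\<^sup>2 + (P * y j)\<^sup>2" for i j
      using zero_le_power2[of "Q * x i + P * y j"] by (simp only: power2_sum)
  qed (use nonneg in auto)
  \<comment> \<open>Regrouping exposes row sums at the \<open>x\<close> terms and column sums at the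
    \<open>y\<close> terms. Bounding them by \<open>P\<close> and \<open>Q\<close> leaves a common
    factor \<open>P * Q\<close> to cancel.\<close>
  also have "\<dots> = (\<Sum>i\<in>I. (\<Sum>j\<in>J. a i j) * (Q * x i)\<^sup>2) + (\<Sum>j\<in>J. (\<Sum>i\<in>I. a i j) * (P * y j)\<^sup>2)"
    by (simp add: distrib_left sum.distrib sum_distrib_right sum.swap[of _ J])
  also have "\<dots> \<le> (\<Sum>i\<in>I. P * (Q * x i)\<^sup>2) + (\<Sum>j\<in>J. Q * (P * y j)\<^sup>2)"
    using row col by (intro add_mono sum_mono mult_right_mono) auto
  also have "\<dots> = P * Q * (Q * (\<Sum>i\<in>I. (x i)\<^sup>2) + P * (\<Sum>j\<in>J. (y j)\<^sup>2))"
    by (simp add: sum_distrib_left power_mult_distrib power2_eq_square algebra_simps)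
  finally show ?thesis
    by (rule mult_left_le_imp_le) (use pos in simp)
qed

lemma size_eq_sum_count:
  assumes "finite S" "set_mset M \<subseteq> S"
  shows "size M = (\<Sum>a\<in>S. count M a)"
  unfolding size_multiset_overloaded_eq
  using assms by (intro sum.mono_neutral_left) (auto simp: not_in_iff)

text \<open>Together with its counterpart for \<open>in_degree\<close>, this lets the maximal
  degrees serve as the row and column bounds in \<open>bilinear_sum_bound\<close>.\<close>

lemma out_degree_eq_sum:
  assumes "mixed_graph G" "u \<in> verts G"
  shows "out_degree G u = (\<Sum>v\<in>verts G. count (arcs G) (u, v))"
proof -
  have "out_degree G u = (\<Sum>a\<in>{u} \<times> verts G. count {#a \<in># arcs G. fst a = u#} a)"
    unfolding out_degree_def using assms
    by (intro size_eq_sum_count) (auto simp: mixed_graph_def)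
  then show ?thesis
    by (simp add: sum.cartesian_product')
qed

lemma in_degree_eq_sum:
  assumes "mixed_graph G" "v \<in> verts G"
  shows "in_degree G v = (\<Sum>u\<in>verts G. count (arcs G) (u, v))"
proof -
  have "in_degree G v = (\<Sum>a\<in>verts G \<times> {v}. count {#a \<in># arcs G. snd a = v#} a)"
    unfolding in_degree_def using assms
    by (intro size_eq_sum_count) (auto simp: mixed_graph_def)
  then show ?thesis
    by (simp add: sum.cartesian_product')
qed

section \<open>Laplacian of the undirected part\<close>

lemma laplacian_matrix_carrier: "laplacian_matrix G vs \<in> carrier_mat (length vs) (length vs)"
  by (auto simp: laplacian_matrix_def degree_matrix_def adjacency_matrix_def)

lemma laplacian_matrix_symmetric: "(laplacian_matrix G vs)\<^sup>T = laplacian_matrix G vs"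
  by (rule eq_matI)
    (auto simp: laplacian_matrix_def degree_matrix_def adjacency_matrix_def mat_diag_def Upair_inject
      intro!: arg_cong[of _ _ "count _"])

lemma laplacian_matrix_undirected_part:
  "laplacian_matrix (undirected_part G) vs = laplacian_matrix G vs"
  by (simp add: laplacian_matrix_def degree_matrix_def adjacency_matrix_def undirected_part_def
      vertex_degree_def)

text \<open>Without loops a diagonal entry is a vertex degree, hence nonnegative, and it is the
  value of the form at a unit vector.\<close>

lemma largest_eigenvalue_laplacian_nonneg:
  assumes loopless: "\<And>v. Upair v v \<notin># edges G" and "vs \<noteq> []"
  shows "largest_eigenvalue (laplacian_matrix G vs) \<ge> 0"
proof -
  let ?L = "laplacian_matrix G vs" and ?n = "length vs"
  let ?e = "unit_vec ?n 0 :: real vec"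
  have n: "?n > 0"
    using assms by simp
  have "count (edges G) (Upair (vs ! 0) (vs ! 0)) = 0"
    using loopless by (simp add: not_in_iff)
  then have "0 \<le> ?L $$ (0, 0)"
    using n by (simp add: laplacian_matrix_def degree_matrix_def adjacency_matrix_def mat_diag_def)
  also have "?L $$ (0, 0) = ?e \<bullet> (?L *\<^sub>v ?e)"
    using n laplacian_matrix_carrier[of G vs] by auto
  also have "\<dots> \<le> largest_eigenvalue ?L"
    using largest_eigenvalue_symmetric(2)[OF laplacian_matrix_carrier laplacian_matrix_symmetric n,
        of ?e] n by simp
  finally show ?thesis .
qed

section \<open>Blocks and quadratic form of the integrated Laplacian\<close>

lemma integrated_laplacian_matrix_carrier:
  "integrated_laplacian_matrix G vs
     \<in> carrier_mat (length vs + length vs) (length vs + length vs)"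
  by (auto simp: integrated_laplacian_matrix_def integrated_degree_matrix_def Let_def
      integrated_adjacency_matrix_def adjacency_matrix_def arc_matrix_def)

text \<open>Separates edges from arcs: edges enter only through the two copies of the ordinary
  Laplacian, arcs only through the diagonal summands and the off-diagonal blocks.\<close>

lemma integrated_laplacian_matrix_blocks:
  "integrated_laplacian_matrix G vs = four_block_mat
     (laplacian_matrix G vs + mat_diag (length vs) (\<lambda>i. real (out_degree G (vs ! i))))
     (- arc_matrix G vs)
     (- (arc_matrix G vs)\<^sup>T)
     (laplacian_matrix G vs + mat_diag (length vs) (\<lambda>i. real (in_degree G (vs ! i))))"
  by (rule eq_matI)
    (auto simp: integrated_laplacian_matrix_def integrated_degree_matrix_def Let_def
      integrated_adjacency_matrix_def laplacian_matrix_def degree_matrix_def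
      adjacency_matrix_def arc_matrix_def mat_diag_def)

lemma integrated_laplacian_matrix_symmetric:
  "(integrated_laplacian_matrix G vs)\<^sup>T = integrated_laplacian_matrix G vs"
proof -
  have "(laplacian_matrix G vs + mat_diag (length vs) f)\<^sup>T
      = laplacian_matrix G vs + mat_diag (length vs) f" for f
    using laplacian_matrix_carrier[of G vs]
    by (subst transpose_add[of _ "length vs" "length vs"])
      (auto simp: laplacian_matrix_symmetric mat_diag_def intro!: arg_cong2[of _ _ _ _ "(+)"] eq_matI)
  moreover have "(- arc_matrix G vs)\<^sup>T = - (arc_matrix G vs)\<^sup>T"
    by (rule eq_matI) auto
  ultimately show ?thesis
    unfolding integrated_laplacian_matrix_blocks
    using laplacian_matrix_carrier[of G vs]
    by (subst transpose_four_block_mat[of _ "length vs" "length vs" _ "length vs" _ "length vs"])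
      (auto simp: arc_matrix_def transpose_uminus)
qed

lemma quadratic_form_mat_diag:
  fixes f :: "nat \<Rightarrow> real"
  assumes "x \<in> carrier_vec n"
  shows "x \<bullet> (mat_diag n f *\<^sub>v x) = (\<Sum>i<n. f i * (x $ i)\<^sup>2)"
proof -
  have "mat_diag n f *\<^sub>v x = vec n (\<lambda>i. f i * x $ i)"
    using assms by (auto intro!: eq_vecI simp: mat_diag_def scalar_prod_def
        if_distrib[of "\<lambda>c. c * _"] sum.delta cong: if_cong)
  then show ?thesis
    using assms by (simp add: scalar_prod_def lessThan_atLeast0 power2_eq_square ac_simps)
qed

text \<open>The off-diagonal blocks are transposes of each other, so they contribute the same mixed
  term twice. The squares over arcs stay expanded because degree terms and mixed term are bounded
  separately.\<close>

lemma quadratic_form_integrated_laplacian: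
  assumes x: "x \<in> carrier_vec (length vs)" and y: "y \<in> carrier_vec (length vs)"
  shows "(x @\<^sub>v y) \<bullet> (integrated_laplacian_matrix G vs *\<^sub>v (x @\<^sub>v y))
      = x \<bullet> (laplacian_matrix G vs *\<^sub>v x) + y \<bullet> (laplacian_matrix G vs *\<^sub>v y)
        + (\<Sum>i<length vs. real (out_degree G (vs ! i)) * (x $ i)\<^sup>2)
        + (\<Sum>i<length vs. real (in_degree G (vs ! i)) * (y $ i)\<^sup>2)
        - 2 * (\<Sum>i<length vs. \<Sum>j<length vs.
                 real (count (arcs G) (vs ! i, vs ! j)) * x $ i * y $ j)"
proof -
  define n where "n = length vs"
  define L where "L = laplacian_matrix G vs"
  define B where "B = arc_matrix G vs"
  define D1 where "D1 = mat_diag n (\<lambda>i. real (out_degree G (vs ! i)))"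
  define D2 where "D2 = mat_diag n (\<lambda>i. real (in_degree G (vs ! i)))"
  have L: "L \<in> carrier_mat n n" and B: "B \<in> carrier_mat n n"
    and D: "D1 \<in> carrier_mat n n" "D2 \<in> carrier_mat n n"
    and xy: "x \<in> carrier_vec n" "y \<in> carrier_vec n"
    using laplacian_matrix_carrier[of G vs] x y
    by (auto simp: n_def L_def B_def D1_def D2_def arc_matrix_def)
  have BT: "B\<^sup>T \<in> carrier_mat n n" "- B \<in> carrier_mat n n" "- B\<^sup>T \<in> carrier_mat n n"
    using B by auto
  have vecs: "L *\<^sub>v x \<in> carrier_vec n" "L *\<^sub>v y \<in> carrier_vec n"
    "D1 *\<^sub>v x \<in> carrier_vec n" "D2 *\<^sub>v y \<in> carrier_vec n"
    "B *\<^sub>v y \<in> carrier_vec n" "B\<^sup>T *\<^sub>v x \<in> carrier_vec n"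
    using L B BT D xy by auto
  have "integrated_laplacian_matrix G vs *\<^sub>v (x @\<^sub>v y)
      = (L *\<^sub>v x + D1 *\<^sub>v x + - (B *\<^sub>v y)) @\<^sub>v (- (B\<^sup>T *\<^sub>v x) + (L *\<^sub>v y + D2 *\<^sub>v y))"
    unfolding integrated_laplacian_matrix_blocks L_def[symmetric] B_def[symmetric]
      n_def[symmetric] D1_def[symmetric] D2_def[symmetric]
    using L D B BT xy
    by (subst four_block_mat_mult_vec[of _ n n _ n _ n])
      (auto simp: add_mult_distrib_mat_vec[of _ n n])
  then have "(x @\<^sub>v y) \<bullet> (integrated_laplacian_matrix G vs *\<^sub>v (x @\<^sub>v y))
      = x \<bullet> (L *\<^sub>v x) + x \<bullet> (D1 *\<^sub>v x) - x \<bullet> (B *\<^sub>v y)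
        - y \<bullet> (B\<^sup>T *\<^sub>v x) + y \<bullet> (L *\<^sub>v y) + y \<bullet> (D2 *\<^sub>v y)"
    using xy vecs B by (simp add: scalar_prod_append[of _ n _ n] scalar_prod_add_distrib[of _ n])
  moreover have "y \<bullet> (B\<^sup>T *\<^sub>v x) = x \<bullet> (B *\<^sub>v y)"
    using transpose_vec_mult_scalar[OF B xy(2,1)] vecs xy
    by (metis comm_scalar_prod)
  moreover have "x \<bullet> (B *\<^sub>v y)
      = (\<Sum>i<n. \<Sum>j<n. real (count (arcs G) (vs ! i, vs ! j)) * x $ i * y $ j)"
    unfolding quadratic_form_eq_sum[OF B xy]
    by (intro sum.cong) (auto simp: B_def arc_matrix_def n_def)
  ultimately show ?thesis
    using quadratic_form_mat_diag[OF xy(1)] quadratic_form_mat_diag[OF xy(2)]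
    by (simp add: L_def D1_def D2_def n_def)
qed

section \<open>Assembling the eigenvalue bound\<close>

theorem theorem3p10:
  fixes G :: "'v mixed_graph" and vs :: "'v list"
  assumes "simple_mixed_graph G"
    and "verts G \<noteq> {}"
    and "distinct vs" and "set vs = verts G"
  shows "largest_eigenvalue (integrated_laplacian_matrix G vs)
           \<le> 2 * largest_eigenvalue (laplacian_matrix (undirected_part G) vs)
             + real (MAX u\<in>verts G. out_degree G u)
             + real (MAX u\<in>verts G. in_degree G u)"
proof -
  define n where "n = length vs"
  define L where "L = laplacian_matrix G vs"
  define \<nu> where "\<nu> = largest_eigenvalue L"
  define P where "P = real (MAX u\<in>verts G. out_degree G u)"
  define Q where "Q = real (MAX u\<in>verts G. in_degree G u)"
  let ?M = "integrated_laplacian_matrix G vs"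
  have G: "mixed_graph G" and "vs \<noteq> []"
    using assms by (auto simp: simple_mixed_graph_def)
  then have n: "n > 0" and fin: "finite (verts G)"
    by (simp_all add: n_def mixed_graph_def)
  have \<nu>: "\<nu> \<ge> 0"
    using assms(1) \<open>vs \<noteq> []\<close> largest_eigenvalue_laplacian_nonneg[of G vs]
    by (simp add: \<nu>_def L_def simple_mixed_graph_def)
  have vert: "vs ! i \<in> verts G" if "i < n" for i
    using that assms(4) nth_mem by (auto simp: n_def)
  have out: "real (out_degree G (vs ! i)) \<le> P" and inn: "real (in_degree G (vs ! i)) \<le> Q"
    if "i < n" for i
    using fin vert[OF that] by (auto simp: P_def Q_def)
  \<comment> \<open>Degrees are sums over vertices, matrix forms are sums over positions in
    \<open>vs\<close>; the enumeration identifies the two.\<close>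
  have reindex: "(\<Sum>u\<in>verts G. h u) = (\<Sum>i<n. h (vs ! i))" for h :: "'v \<Rightarrow> nat"
    using sum.reindex_bij_betw[OF bij_betw_nth[OF assms(3) refl assms(4)[symmetric]], of h]
    by (simp add: n_def)
  have "?M \<in> carrier_mat (n + n) (n + n)"
    using integrated_laplacian_matrix_carrier[of G vs] by (simp add: n_def)
  then have "largest_eigenvalue ?M \<le> \<nu> + P + Q"
  proof (rule largest_eigenvalue_le[OF _ integrated_laplacian_matrix_symmetric])
    fix w :: "real vec"
    assume w: "w \<in> carrier_vec (n + n)"
    define x where "x = vec_first w n"
    define y where "y = vec_last w n"
    have x: "x \<in> carrier_vec n" and y: "y \<in> carrier_vec n"
      and split: "w = x @\<^sub>v y"
      using w by (simp_all add: x_def y_def)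
    have "x \<bullet> (L *\<^sub>v x) \<le> \<nu> * (x \<bullet> x)" "y \<bullet> (L *\<^sub>v y) \<le> \<nu> * (y \<bullet> y)"
      unfolding \<nu>_def L_def
      using largest_eigenvalue_symmetric(2)[OF laplacian_matrix_carrier laplacian_matrix_symmetric]
        n x y by (auto simp: n_def)
    moreover have "(\<Sum>i<n. real (out_degree G (vs ! i)) * (x $ i)\<^sup>2) \<le> P * (x \<bullet> x)"
      unfolding scalar_prod_self_eq_sum[OF x] sum_distrib_left
      using out by (intro sum_mono mult_right_mono) auto
    moreover have "(\<Sum>i<n. real (in_degree G (vs ! i)) * (y $ i)\<^sup>2) \<le> Q * (y \<bullet> y)"
      unfolding scalar_prod_self_eq_sum[OF y] sum_distrib_left
      using inn by (intro sum_mono mult_right_mono) auto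
    \<comment> \<open>Here \<open>P\<close> and \<open>Q\<close> are swapped relative to the two
      degree terms, so altogether both halves of \<open>w\<close> get the coefficient
      \<open>P + Q\<close>.\<close>
    moreover have "- 2 * (\<Sum>i<n. \<Sum>j<n. real (count (arcs G) (vs ! i, vs ! j)) * x $ i * y $ j)
        \<le> Q * (x \<bullet> x) + P * (y \<bullet> y)"
      unfolding scalar_prod_self_eq_sum[OF x] scalar_prod_self_eq_sum[OF y]
    proof (rule bilinear_sum_bound)
      show "(\<Sum>j<n. real (count (arcs G) (vs ! i, vs ! j))) \<le> P" if "i \<in> {..<n}" for i
        using out[of i] that out_degree_eq_sum[OF G vert, of i] by (simp add: reindex)
      show "(\<Sum>i<n. real (count (arcs G) (vs ! i, vs ! j))) \<le> Q" if "j \<in> {..<n}" for j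
        using inn[of j] that in_degree_eq_sum[OF G vert, of j] by (simp add: reindex)
    qed (auto simp: P_def Q_def)
    moreover have "w \<bullet> w = x \<bullet> x + y \<bullet> y"
      unfolding split using x y by (simp add: scalar_prod_append[of _ n _ n])
    ultimately show "w \<bullet> (?M *\<^sub>v w) \<le> (\<nu> + P + Q) * (w \<bullet> w)"
      using quadratic_form_integrated_laplacian[of x vs y G] x y
      by (simp add: split n_def L_def algebra_simps)
  qed (use n in simp)
  then show ?thesis
    using \<nu> by (simp add: \<nu>_def L_def P_def Q_def laplacian_matrix_undirected_part)
qed

end
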